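(* Let $X$ be a compact metric space and $f:X\to X$ be a distal homeomorphism. Then $f$ has the pseudo-orbit tracing property (POTP) if and only if $X$ is totally disconnected.
   Context: Let $f:X\to X$ be a homeomorphism of a metric space $(X,d)$. For $\delta>0$, a bi-infinite sequence $\xi=(\xi_n)_{n\in\mathbb{Z}}$ of points of $X$ is a $\delta$-pseudo-orbit if $d(f(\xi_n),\xi_{n+1})\leq\delta$ for all $n\in\mathbb{Z}$. For $\epsilon>0$, $\xi$ can be $\epsilon$-shadowed if there is $x\in X$ such that $d(f^n(x),\xi_n)\leq\epsilon$ for all $n\in\mathbb{Z}$. $f$ has the POTP if for every $\epsilon>0$ there is $\delta>0$ such that every $\delta$-pseudo-orbit can be $\epsilon$-shadowed. The homeomorphism $f$ is distal if $\inf_{n\in\mathbb{Z}}d(f^n(x),f^n(y))>0$ for all distinct points $x,y\in X$. $X$ is totally disconnected if for every $p\in X$ the connected component of $X$ containing $p$ is $\{p\}$. *)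

theory Defs
  imports "HOL-Analysis.Analysis"
begin

text \<open>
  The space is a subset \<open>X\<close> of a metric type, with the induced metric and topology. The inverse
  of \<open>f\<close> is taken relative to \<open>X\<close>, so for a bijection \<open>f\<close> of \<open>X\<close> the values of
  \<open>iterate X f n\<close> on \<open>X\<close> do not depend on \<open>f\<close> outside \<open>X\<close>.
\<close>

definition iterate :: "'a set \<Rightarrow> ('a \<Rightarrow> 'a) \<Rightarrow> int \<Rightarrow> 'a \<Rightarrow> 'a" where
  "iterate X f n = (if n \<ge> 0 then f ^^ nat n else inv_into X f ^^ nat (- n))"

definition pseudo_orbit ::
    "'a::metric_space set \<Rightarrow> ('a \<Rightarrow> 'a) \<Rightarrow> real \<Rightarrow> (int \<Rightarrow> 'a) \<Rightarrow> bool" where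
  "pseudo_orbit X f \<delta> \<xi> \<longleftrightarrow>
     (\<forall>n. \<xi> n \<in> X) \<and> (\<forall>n. dist (f (\<xi> n)) (\<xi> (n + 1)) \<le> \<delta>)"

definition can_be_shadowed ::
    "'a::metric_space set \<Rightarrow> ('a \<Rightarrow> 'a) \<Rightarrow> real \<Rightarrow> (int \<Rightarrow> 'a) \<Rightarrow> bool" where
  "can_be_shadowed X f \<epsilon> \<xi> \<longleftrightarrow> (\<exists>x\<in>X. \<forall>n. dist (iterate X f n x) (\<xi> n) \<le> \<epsilon>)"

definition POTP :: "'a::metric_space set \<Rightarrow> ('a \<Rightarrow> 'a) \<Rightarrow> bool" where
  "POTP X f \<longleftrightarrow>
     (\<forall>\<epsilon>>0. \<exists>\<delta>>0. \<forall>\<xi>. pseudo_orbit X f \<delta> \<xi> \<longrightarrow> can_be_shadowed X f \<epsilon> \<xi>)"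

definition distal :: "'a::metric_space set \<Rightarrow> ('a \<Rightarrow> 'a) \<Rightarrow> bool" where
  "distal X f \<longleftrightarrow>
     (\<forall>x\<in>X. \<forall>y\<in>X. x \<noteq> y \<longrightarrow> (INF n. dist (iterate X f n x) (iterate X f n y)) > 0)"

definition totally_disconnected :: "'a::topological_space set \<Rightarrow> bool" where
  "totally_disconnected X \<longleftrightarrow> (\<forall>p\<in>X. connected_component_set X p = {p})"

end

theory Submission
  imports Defs
begin

text \<open>
  Both directions rest on one recurrence property of a distal system: finitely many points of
  \<open>X\<close> return close to themselves at a common positive time. It comes from the semigroup of
  pointwise limits of the maps \<open>f ^^ n\<close> with \<open>n > 0\<close>, taken in the compact product of copies of
  \<open>X\<close> indexed by \<open>X\<close>. By the Ellis--Numakura lemma this semigroup contains an idempotent \<open>u\<close>.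
  The orbits of \<open>u x\<close> and \<open>x\<close> come arbitrarily close to each other because \<open>u (u x) = u x\<close>, so
  distality gives \<open>u x = x\<close>. Thus the identity is a pointwise limit of positive iterates
  (\<open>simultaneous_recurrence\<close>).

  On the topological side, a compact space is totally disconnected iff the endpoints of a chain
  with small steps are close together, however long the chain is
  (\<open>totally_disconnected_iff_chains\<close>).

  If shadowing holds, let \<open>n\<close> be a common return time of the points of a chain from \<open>x\<close> to \<open>y\<close>.
  Following each of these points for \<open>n\<close> steps and then jumping to the next one gives a
  pseudo-orbit, which can stay at \<open>y\<close> for ever. A shadowing point starts near \<open>x\<close> and is near \<open>y\<close>
  at all sufficiently large multiples of \<open>n\<close>; being recurrent along these multiples, it forces \<open>x\<close> and \<open>y\<close> to be
  close (\<open>shadowing_bounds_chains\<close>).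

  Suppose conversely that chains with small steps have endpoints close together. Being joined by a
  chain with steps below a fixed small bound is then an equivalence relation with
  open classes of small diameter. By recurrence, two points whose futures stay equivalent
  are equivalent themselves, and by compactness finitely many future times are enough. So
  equivalence at all times up to a certain bound is an equivalence relation that \<open>f\<close> preserves in
  both directions (\<open>invariant_equivalence\<close>). A pseudo-orbit whose jumps stay inside the classes is
  shadowed by the orbit of its point at time \<open>0\<close>.
\<close>

section \<open>Idempotents in compact semigroups\<close>

text \<open>
  A minimal closed subsemigroup \<open>B\<close> exists by compactness and Zorn's lemma. For \<open>p \<in> B\<close>, both
  \<open>B p\<close> and \<open>{q \<in> B. q p = p}\<close> are closed subsemigroups of \<open>B\<close>, the second one nonempty because
  \<open>B p = B\<close>. By minimality both equal \<open>B\<close>, hence \<open>p p = p\<close>. Only right translations are assumed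
  continuous, because this is what composition of functions satisfies in the pointwise
  topology.
\<close>
lemma Ellis_Numakura:
  fixes T :: "'s topology" and m :: "'s \<Rightarrow> 's \<Rightarrow> 's"
  assumes comp: "compact_space T" and haus: "Hausdorff_space T" and ne: "topspace T \<noteq> {}"
    and mult: "\<And>p q. p \<in> topspace T \<Longrightarrow> q \<in> topspace T \<Longrightarrow> m p q \<in> topspace T"
    and assoc: "\<And>p q r. \<lbrakk>p \<in> topspace T; q \<in> topspace T; r \<in> topspace T\<rbrakk>
      \<Longrightarrow> m (m p q) r = m p (m q r)"
    and cont: "\<And>p. p \<in> topspace T \<Longrightarrow> continuous_map T T (\<lambda>q. m q p)"
  obtains u where "u \<in> topspace T" "m u u = u"
proof -
  define \<A> where "\<A> = {B. closedin T B \<and> B \<noteq> {} \<and> (\<forall>a\<in>B. \<forall>b\<in>B. m a b \<in> B)}"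
  have sub: "B \<subseteq> topspace T" if "B \<in> \<A>" for B
    using that closedin_subset by (auto simp: \<A>_def)
  have "\<exists>B\<in>\<A>. \<forall>C\<in>\<A>. B \<supseteq> C \<longrightarrow> C = B"
  proof (rule predicate_Zorn)
    show "partial_order_on \<A> (relation_of (\<supseteq>) \<A>)"
      by (rule partial_order_on_relation_ofI) auto
  next
    fix \<C> assume "\<C> \<in> Chains (relation_of (\<supseteq>) \<A>)"
    then have \<C>: "\<C> \<subseteq> \<A>" "\<And>B C. B \<in> \<C> \<Longrightarrow> C \<in> \<C> \<Longrightarrow> B \<subseteq> C \<or> C \<subseteq> B"
      by (auto simp: Chains_def relation_of_def)
    show "\<exists>U\<in>\<A>. \<forall>B\<in>\<C>. B \<supseteq> U"
    proof (cases "\<C> = {}")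
      case True
      have "topspace T \<in> \<A>" using ne mult by (auto simp: \<A>_def)
      with True show ?thesis by auto
    next
      case False
      have "\<Inter>\<F> \<noteq> {}" if "finite \<F>" "\<F> \<subseteq> \<C>" for \<F>
      proof (cases "\<F> = {}")
        case False
        have "\<Inter>\<F> \<in> \<F>"
          using Inter_in_chain[of \<F> \<C>] that False \<C>(2) by (auto simp: subset_chain_def subset_iff)
        then show ?thesis using \<open>\<F> \<subseteq> \<C>\<close> \<C>(1) by (auto simp: \<A>_def)
      qed simp
      moreover have "\<forall>B\<in>\<C>. closedin T B" using \<C>(1) by (auto simp: \<A>_def)
      ultimately have "\<Inter>\<C> \<noteq> {}"
        using comp[unfolded compact_space_fip, rule_format, of \<C>] by simp
      moreover have "closedin T (\<Inter>\<C>)"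
        using False \<C>(1) by (intro closedin_Inter) (auto simp: \<A>_def)
      moreover have "m a b \<in> \<Inter>\<C>" if "a \<in> \<Inter>\<C>" "b \<in> \<Inter>\<C>" for a b
      proof (rule InterI)
        fix B assume "B \<in> \<C>"
        then show "m a b \<in> B" using that \<C>(1) by (auto simp: \<A>_def)
      qed
      ultimately have "\<Inter>\<C> \<in> \<A>" unfolding \<A>_def by blast
      then show ?thesis by blast
    qed
  qed
  then obtain B where B: "B \<in> \<A>" and min: "\<And>C. C \<in> \<A> \<Longrightarrow> C \<subseteq> B \<Longrightarrow> C = B"
    by metis
  then obtain p where p: "p \<in> B" by (auto simp: \<A>_def)
  have pT: "p \<in> topspace T" using p sub B by auto
  have mB: "m a b \<in> B" if "a \<in> B" "b \<in> B" for a b using that B by (auto simp: \<A>_def)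
  have cB: "closedin T B" using B by (auto simp: \<A>_def)
  have "(\<lambda>q. m q p) ` B \<in> \<A>"
  proof -
    have "compactin T B" using cB comp closedin_compact_space by blast
    then have "closedin T ((\<lambda>q. m q p) ` B)"
      using image_compactin cont[OF pT] haus compactin_imp_closedin by blast
    moreover have "m (m a p) (m b p) = m (m (m a p) b) p" if "a \<in> B" "b \<in> B" for a b
      using that sub[OF B] pT mult by (subst assoc) (auto simp: subset_iff)
    ultimately show ?thesis using p mB by (auto simp: \<A>_def)
  qed
  then have "(\<lambda>q. m q p) ` B = B" using mB p by (intro min) auto
  then obtain q where q: "q \<in> B" "m q p = p" using p by (metis imageE)
  have "{q \<in> B. m q p = p} \<in> \<A>"
  proof -
    have "closedin T {p}" using haus pT by (simp add: closedin_Hausdorff_singleton)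
    then have "closedin T ({q \<in> topspace T. m q p \<in> {p}} \<inter> B)"
      using closedin_continuous_map_preimage[OF cont[OF pT]] cB by blast
    moreover have "{q \<in> topspace T. m q p \<in> {p}} \<inter> B = {q \<in> B. m q p = p}"
      using sub[OF B] by auto
    ultimately have "closedin T {q \<in> B. m q p = p}" by simp
    moreover have "m (m a b) p = p" if "a \<in> B" "b \<in> B" "m a p = p" "m b p = p" for a b
      using that sub[OF B] pT by (subst assoc) auto
    ultimately show ?thesis using q mB by (auto simp: \<A>_def)
  qed
  then have "{q \<in> B. m q p = p} = B" by (intro min) auto
  then show ?thesis using that p pT by auto
qed

section \<open>Recurrence in distal systems\<close>

text \<open>
  Distality enters through nonnegative times only, which is a formally weaker condition than a
  bound over all integer times and passes to the powers \<open>f ^^ k\<close>.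
\<close>
locale distal_system =
  fixes X :: "'a::metric_space set" and f :: "'a \<Rightarrow> 'a"
  assumes compact: "compact X" and cont: "continuous_on X f" and maps: "f \<in> X \<rightarrow> X"
    and separated: "\<And>x y. \<lbrakk>x \<in> X; y \<in> X; x \<noteq> y\<rbrakk>
      \<Longrightarrow> \<exists>e>0. \<forall>n. e \<le> dist ((f ^^ n) x) ((f ^^ n) y)"
begin

lemma funpow_in: "x \<in> X \<Longrightarrow> (f ^^ n) x \<in> X"
  using maps by (induction n) auto

lemma continuous_on_funpow: "continuous_on X (f ^^ n)"
proof (induction n)
  case (Suc n)
  have "(f ^^ n) ` X \<subseteq> X" using funpow_in by blast
  then have "continuous_on X (f \<circ> f ^^ n)"
    using Suc cont continuous_on_compose continuous_on_subset by blast
  then show ?case by (simp add: o_def)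
qed (auto simp: id_def)

lemma distal_system_funpow: "distal_system X (f ^^ k)"
proof
  show "\<exists>e>0. \<forall>n. e \<le> dist (((f ^^ k) ^^ n) x) (((f ^^ k) ^^ n) y)"
    if "x \<in> X" "y \<in> X" "x \<noteq> y" for x y
    using separated[OF that] by (auto simp: funpow_mult)
qed (auto simp: compact continuous_on_funpow funpow_in)

text \<open>
  The identity map of \<open>X\<close> is shown to be a pointwise limit of positive iterates of \<open>f\<close>: it is the
  idempotent in the closure of these iterates, for composition of extensional functions on \<open>X\<close>.
\<close>
lemma simultaneous_recurrence:
  assumes "finite S" "S \<subseteq> X" "e > 0"
  obtains n where "n > 0" "\<And>x. x \<in> S \<Longrightarrow> dist ((f ^^ n) x) x < e"
proof (cases "X = {}")
  case True
  then show thesis using assms that[of 1] by auto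
next
  case False
  define P where "P = product_topology (\<lambda>_. top_of_set X) X"
  define r where "r n = restrict (f ^^ n) X" for n
  define A where "A = P closure_of (r ` {0<..})"
  have topP: "topspace P = X \<rightarrow>\<^sub>E X" by (simp add: P_def)
  have rP: "r n \<in> topspace P" for n unfolding topP r_def using funpow_in by auto
  have AP: "A \<subseteq> topspace P" unfolding A_def by (rule closure_of_subset_topspace)
  have rA: "r ` {0<..} \<subseteq> A"
    unfolding A_def using rP by (intro closure_of_subset) auto
  have proj: "continuous_map P (top_of_set X) (\<lambda>p. p x)" if "x \<in> X" for x
    unfolding P_def using continuous_map_product_projection[OF that] by fastforce
  have right: "continuous_map P P (\<lambda>p. compose X p q)" if "q \<in> topspace P" for q
  proof -
    have "continuous_map P (top_of_set X) (\<lambda>p. compose X p q x)" if "x \<in> X" for x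
      using proj[of "q x"] that \<open>q \<in> topspace P\<close> by (auto simp: topP compose_def)
    then show ?thesis
      unfolding P_def continuous_map_componentwise by (auto simp: compose_def extensional_def)
  qed
  have left: "continuous_map P P (\<lambda>q. compose X (r n) q)" for n
  proof -
    have fn: "continuous_map (top_of_set X) (top_of_set X) (f ^^ n)"
      using continuous_on_funpow funpow_in by auto
    have "continuous_map P (top_of_set X) (\<lambda>q. compose X (r n) q x)" if "x \<in> X" for x
    proof -
      have "continuous_map P (top_of_set X) (f ^^ n \<circ> (\<lambda>q. q x))"
        using proj[OF that] fn continuous_map_compose by blast
      then show ?thesis
        by (rule continuous_map_eq) (use that in \<open>auto simp: topP compose_def r_def\<close>)
    qed
    then show ?thesis
      unfolding P_def continuous_map_componentwise by (auto simp: compose_def extensional_def)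
  qed
  have comp_r: "compose X (r n) (r k) = r (n + k)" for n k
    unfolding r_def compose_def by (auto simp: funpow_in funpow_add)
  \<comment> \<open>Left translation by an arbitrary limit map need not be continuous, so closedness under
    composition is shown first for an iterate on the left and then for a limit of iterates.\<close>
  have left_A: "compose X (r n) q \<in> A" if "n > 0" "q \<in> A" for n q
  proof -
    have "compose X (r n) q \<in> P closure_of (\<lambda>q. compose X (r n) q) ` r ` {0<..}"
      using continuous_map_image_closure_subset[OF left] \<open>q \<in> A\<close> unfolding A_def by blast
    also have "\<dots> \<subseteq> A"
      unfolding A_def by (rule closure_of_mono) (auto simp: comp_r)
    finally show ?thesis .
  qed
  have mult_A: "compose X p q \<in> A" if "p \<in> A" "q \<in> A" for p q
  proof -
    have "compose X p q \<in> P closure_of (\<lambda>p. compose X p q) ` r ` {0<..}"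
      using continuous_map_image_closure_subset[OF right] that AP unfolding A_def by blast
    also have "\<dots> \<subseteq> P closure_of A"
      using left_A[OF _ \<open>q \<in> A\<close>] by (intro closure_of_mono) auto
    finally show ?thesis by (simp add: A_def)
  qed
  have topA: "topspace (subtopology P A) = A" using AP by auto
  obtain u where "u \<in> A" and idem: "compose X u u = u"
  proof (rule Ellis_Numakura[of "subtopology P A" "compose X"])
    have "compact_space P"
      unfolding P_def compact_space_product_topology
      using compact by (simp add: compact_space_subtopology compactin_subtopology)
    then show "compact_space (subtopology P A)"
      by (intro compact_space_subtopology closedin_compact_space) (simp_all add: A_def)
    show "Hausdorff_space (subtopology P A)"
      unfolding P_def
      by (intro Hausdorff_space_subtopology) (simp add: Hausdorff_space_product_topology Hausdorff_space_subtopology)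
    show "topspace (subtopology P A) \<noteq> {}" using rA topA by auto
    show "continuous_map (subtopology P A) (subtopology P A) (\<lambda>q. compose X q p)"
      if "p \<in> topspace (subtopology P A)" for p
      using right[of p] that AP mult_A
      by (auto simp: continuous_map_in_subtopology continuous_map_from_subtopology topA)
    show "compose X (compose X p q) s = compose X p (compose X q s)"
      if "p \<in> topspace (subtopology P A)" "q \<in> topspace (subtopology P A)"
        "s \<in> topspace (subtopology P A)" for p q s
    proof -
      have "s \<in> X \<rightarrow> X" using that topA AP topP by auto
      then show ?thesis by (auto simp: compose_def fun_eq_iff)
    qed
  qed (use mult_A topA in auto)
  have uX: "u x \<in> X" if "x \<in> X" for x using \<open>u \<in> A\<close> AP topP that by auto
  have approx: "\<exists>n>0. \<forall>x\<in>F. dist ((f ^^ n) x) (u x) < d" if F: "finite F" "F \<subseteq> X" "d > 0" for F d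
  proof -
    define W where "W = topspace P \<inter> (\<Inter>x\<in>F. {p \<in> topspace P. p x \<in> X \<inter> ball (u x) d})"
    have "openin P {p \<in> topspace P. p x \<in> X \<inter> ball (u x) d}" if "x \<in> F" for x
    proof (rule openin_continuous_map_preimage[OF proj])
      show "openin (top_of_set X) (X \<inter> ball (u x) d)" by (simp add: openin_open_Int)
    qed (use F that in auto)
    then have "openin P W"
      unfolding W_def by (subst Int_commute) (rule openin_INT[OF F(1)])
    moreover have "u \<in> W" using \<open>u \<in> A\<close> AP uX F by (auto simp: W_def)
    ultimately obtain n where "n > 0" "r n \<in> W"
      using \<open>u \<in> A\<close> unfolding A_def in_closure_of by blast
    then have "dist ((f ^^ n) x) (u x) < d" if "x \<in> F" for x
      using that F by (auto simp: W_def r_def dist_commute subset_iff)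
    with \<open>n > 0\<close> show ?thesis by blast
  qed
  \<comment> \<open>At a time when the iterate approximates \<open>u\<close> at both \<open>x\<close> and \<open>u x\<close>, the images of
    \<open>x\<close> and \<open>u x\<close> are both close to \<open>u x\<close>.\<close>
  have u_id: "u x = x" if "x \<in> X" for x
  proof (rule ccontr)
    assume "u x \<noteq> x"
    then obtain d where d: "d > 0" "\<And>n. d \<le> dist ((f ^^ n) (u x)) ((f ^^ n) x)"
      using separated[of "u x" x] uX \<open>x \<in> X\<close> by blast
    have "u (u x) = u x" using idem \<open>x \<in> X\<close> by (metis compose_eq)
    moreover obtain n where
      "dist ((f ^^ n) x) (u x) < d / 2" "dist ((f ^^ n) (u x)) (u (u x)) < d / 2"
      using approx[of "{x, u x}" "d / 2"] uX[OF \<open>x \<in> X\<close>] \<open>x \<in> X\<close> d(1)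
      by (metis empty_subsetI finite.emptyI finite.insertI half_gt_zero insertCI insert_subset)
    ultimately have "dist ((f ^^ n) (u x)) ((f ^^ n) x) < d"
      by (metis dist_triangle_half_l)
    with d(2)[of n] show False by simp
  qed
  show thesis
    using approx[of S e] assms u_id that by (metis subsetD)
qed

lemma simultaneous_recurrence_multiple:
  assumes "finite S" "S \<subseteq> X" "e > 0" "k > 0"
  obtains n where "n > 0" "k dvd n" "\<And>x. x \<in> S \<Longrightarrow> dist ((f ^^ n) x) x < e"
proof -
  obtain j where j: "j > 0" "\<And>x. x \<in> S \<Longrightarrow> dist (((f ^^ k) ^^ j) x) x < e"
    using distal_system.simultaneous_recurrence[OF distal_system_funpow assms(1-3)] by blast
  show thesis
    by (rule that[of "k * j"]) (use j \<open>k > 0\<close> in \<open>auto simp: funpow_mult\<close>)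
qed

end

section \<open>Chains and total disconnectedness\<close>

definition chain :: "'a::metric_space set \<Rightarrow> real \<Rightarrow> 'a \<Rightarrow> 'a \<Rightarrow> bool" where
  "chain X d = (\<lambda>x y. x \<in> X \<and> y \<in> X \<and> dist x y < d)\<^sup>*\<^sup>*"

lemma chain_step: "\<lbrakk>x \<in> X; y \<in> X; dist x y < d\<rbrakk> \<Longrightarrow> chain X d x y"
  by (simp add: chain_def r_into_rtranclp)

lemma chain_trans: "\<lbrakk>chain X d x y; chain X d y z\<rbrakk> \<Longrightarrow> chain X d x z"
  unfolding chain_def by (rule rtranclp_trans)

lemma chain_sym:
  assumes "chain X d x y" shows "chain X d y x"
proof -
  have "symp (\<lambda>x y. x \<in> X \<and> y \<in> X \<and> dist x y < d)"
    by (auto simp: symp_def dist_commute)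
  then show ?thesis using assms unfolding chain_def by (blast dest: symp_rtranclp sympD)
qed

lemma chain_in_clopen:
  assumes "chain X d x y" "x \<in> T" and gap: "\<And>s t. \<lbrakk>s \<in> T; t \<in> X - T\<rbrakk> \<Longrightarrow> d \<le> dist s t"
  shows "y \<in> T"
  using assms(1,2) unfolding chain_def
  by (induction rule: rtranclp_induct) (use gap in \<open>force+\<close>)

lemma connected_imp_chain:
  assumes "connected C" "C \<subseteq> X" "x \<in> C" "y \<in> C" "d > 0"
  shows "chain X d x y"
proof (rule connected_equivalence_relation[OF assms(1,3,4)])
  fix a assume "a \<in> C"
  have "openin (top_of_set C) (C \<inter> ball a d)" by (simp add: openin_open_Int)
  moreover have "\<forall>z\<in>C \<inter> ball a d. chain X d a z"
    using \<open>a \<in> C\<close> \<open>C \<subseteq> X\<close> by (auto intro: chain_step)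
  ultimately show "\<exists>T. openin (top_of_set C) T \<and> a \<in> T \<and> (\<forall>z\<in>T. chain X d a z)"
    using \<open>a \<in> C\<close> \<open>d > 0\<close> by (intro exI[of _ "C \<inter> ball a d"]) auto
qed (auto intro: chain_sym chain_trans)

text \<open>
  In a compact Hausdorff space the connected component of a point is its quasi-component, the
  intersection of the clopen sets containing it.
\<close>
lemma clopen_separation:
  fixes X :: "'a::metric_space set"
  assumes "compact X" "totally_disconnected X" "x \<in> X" "y \<in> X" "x \<noteq> y"
  obtains T where "closedin (top_of_set X) T" "openin (top_of_set X) T" "x \<in> T" "y \<notin> T"
proof -
  have "compact_space (top_of_set X)" "Hausdorff_space (top_of_set X)"
    using \<open>compact X\<close> by (simp_all add: compact_space_subtopology Hausdorff_space_subtopology)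
  then have "quasi_components_of (top_of_set X) = connected_components_of (top_of_set X)"
    by (intro quasi_eq_connected_components_of) simp
  then have "quasi_component_of (top_of_set X) x = connected_component_of (top_of_set X) x"
    by (simp add: quasi_eq_connected_components_of_pointwise_alt)
  moreover have "\<not> connected_component_of (top_of_set X) x y"
  proof
    assume "connected_component_of (top_of_set X) x y"
    then have "connected_component X x y"
      by (auto simp: connected_component_of_def connected_component_def connectedin_subtopology)
    then show False using assms by (auto simp: totally_disconnected_def)
  qed
  ultimately have "\<not> quasi_component_of (top_of_set X) x y" by simp
  then show thesis
    unfolding quasi_component_of using that \<open>x \<in> X\<close> \<open>y \<in> X\<close> by auto
qed

text \<open>
  The indicator function of a clopen set is continuous, hence uniformly continuous on a compact
  space.
\<close>
lemma clopen_gap: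
  assumes "compact X" "closedin (top_of_set X) T" "openin (top_of_set X) T"
  obtains d where "d > 0" "\<And>s t. \<lbrakk>s \<in> T; t \<in> X - T\<rbrakk> \<Longrightarrow> d \<le> dist s t"
proof -
  have X: "T \<union> (X - T) = X" using closedin_subset[OF assms(2)] by auto
  have "closedin (top_of_set X) (X - T)" using assms(3) by (simp add: closedin_diff)
  then have "continuous_on (T \<union> (X - T)) (\<lambda>x. if x \<in> T then 0 else 1 :: real)"
    using assms(2) by (intro continuous_on_cases_local) (auto simp only: X intro: continuous_on_const)
  then have "uniformly_continuous_on X (\<lambda>x. if x \<in> T then 0 else 1 :: real)"
    unfolding X using assms(1) by (rule compact_uniformly_continuous)
  then obtain d where d: "d > 0" "\<And>s t. \<lbrakk>s \<in> X; t \<in> X; dist t s < d\<rbrakk>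
      \<Longrightarrow> dist (if t \<in> T then 0 else 1 :: real) (if s \<in> T then 0 else 1) < 1"
    unfolding uniformly_continuous_on_def by (metis zero_less_one)
  have "d \<le> dist s t" if "s \<in> T" "t \<in> X - T" for s t
    using d(2)[of t s] that X by (force simp: not_less[symmetric])
  then show thesis using that d(1) by blast
qed

text \<open>
  If chains with steps tending to \<open>0\<close> had endpoints at distance at least \<open>e\<close>, then a clopen set
  would separate limits of these endpoints; but a clopen set has positive distance from its complement, so no chain with
  sufficiently small steps can leave it. Conversely, two points of a connected set are joined by
  chains with arbitrarily small steps.
\<close>
lemma totally_disconnected_iff_chains:
  assumes "compact X"
  shows "totally_disconnected X \<longleftrightarrow>
    (\<forall>e>0. \<exists>d>0. \<forall>x\<in>X. \<forall>y\<in>X. chain X d x y \<longrightarrow> dist x y < e)"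
proof
  assume td: "totally_disconnected X"
  show "\<forall>e>0. \<exists>d>0. \<forall>x\<in>X. \<forall>y\<in>X. chain X d x y \<longrightarrow> dist x y < e"
  proof (rule ccontr)
    assume "\<not> ?thesis"
    then obtain e where e: "e > 0"
      and ex: "\<And>d. d > 0 \<Longrightarrow> \<exists>x\<in>X. \<exists>y\<in>X. chain X d x y \<and> e \<le> dist x y"
      by (meson not_less)
    have "\<forall>n. \<exists>p. p \<in> X \<times> X \<and> chain X (inverse (Suc n)) (fst p) (snd p) \<and> e \<le> dist (fst p) (snd p)"
    proof
      fix n
      obtain x y where "x \<in> X" "y \<in> X" "chain X (inverse (Suc n)) x y" "e \<le> dist x y"
        using ex[of "inverse (Suc n)"] by auto
      then show "\<exists>p. p \<in> X \<times> X \<and> chain X (inverse (Suc n)) (fst p) (snd p) \<and> e \<le> dist (fst p) (snd p)"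
        by (intro exI[of _ "(x, y)"]) auto
    qed
    then obtain s where s: "\<And>n. s n \<in> X \<times> X"
      and ch: "\<And>n. chain X (inverse (Suc n)) (fst (s n)) (snd (s n))"
      and far: "\<And>n. e \<le> dist (fst (s n)) (snd (s n))" by metis
    have "compact (X \<times> X)" using assms compact_Times by blast
    then obtain l r where l: "l \<in> X \<times> X" and r: "strict_mono r" and lim: "(s \<circ> r) \<longlonglongrightarrow> l"
      using s unfolding compact_def by metis
    have lim1: "(\<lambda>n. fst (s (r n))) \<longlonglongrightarrow> fst l" and lim2: "(\<lambda>n. snd (s (r n))) \<longlonglongrightarrow> snd l"
      using tendsto_fst[OF lim] tendsto_snd[OF lim] by (simp_all add: o_def)
    have "e \<le> dist (fst l) (snd l)"
      by (rule tendsto_lowerbound[OF tendsto_dist[OF lim1 lim2]]) (auto simp: far)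
    then have ne: "fst l \<noteq> snd l" using e by auto
    obtain T where T: "closedin (top_of_set X) T" "openin (top_of_set X) T"
      "fst l \<in> T" "snd l \<notin> T"
      by (rule clopen_separation[OF assms td _ _ ne]) (use l in auto)
    obtain d where d: "d > 0" "\<And>s t. \<lbrakk>s \<in> T; t \<in> X - T\<rbrakk> \<Longrightarrow> d \<le> dist s t"
      using clopen_gap[OF assms T(1,2)] by blast
    have "\<forall>\<^sub>F n in sequentially. dist (fst (s (r n))) (fst l) < d"
      "\<forall>\<^sub>F n in sequentially. dist (snd (s (r n))) (snd l) < d"
      using lim1 lim2 d(1) by (auto dest: tendstoD)
    moreover have "\<forall>\<^sub>F n in sequentially. inverse (real (Suc n)) < d"
      using order_tendstoD(2)[OF LIMSEQ_inverse_real_of_nat d(1)] .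
    ultimately have "\<forall>\<^sub>F n in sequentially. dist (fst (s (r n))) (fst l) < d \<and>
        dist (snd (s (r n))) (snd l) < d \<and> inverse (real (Suc n)) < d"
      by eventually_elim auto
    then obtain n where n: "dist (fst (s (r n))) (fst l) < d" "dist (snd (s (r n))) (snd l) < d"
        "inverse (real (Suc n)) < d"
      using eventually_happens'[OF sequentially_bot] by blast
    have "inverse (real (Suc (r n))) \<le> inverse (real (Suc n))"
      using seq_suble[OF r, of n] by (simp add: le_imp_inverse_le)
    then have "inverse (real (Suc (r n))) \<le> d" using n(3) by linarith
    have in_X: "fst (s (r n)) \<in> X" "snd (s (r n)) \<in> X" using s[of "r n"] by auto
    have "fst (s (r n)) \<in> T"
      using d(2)[OF T(3), of "fst (s (r n))"] n(1) in_X by (auto simp: dist_commute)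
    then have "snd (s (r n)) \<in> T"
      by (rule chain_in_clopen[OF ch]) (rule order_trans[OF \<open>inverse (real (Suc (r n))) \<le> d\<close> d(2)])
    moreover have "snd l \<in> X - T" using l T by auto
    ultimately show False using d(2)[of "snd (s (r n))" "snd l"] n(2) by simp
  qed
next
  assume small: "\<forall>e>0. \<exists>d>0. \<forall>x\<in>X. \<forall>y\<in>X. chain X d x y \<longrightarrow> dist x y < e"
  have "q = p" if "connected_component X p q" for p q
  proof -
    obtain C where C: "connected C" "C \<subseteq> X" "p \<in> C" "q \<in> C"
      using \<open>connected_component X p q\<close> by (auto simp: connected_component_def)
    have "dist p q < e" if "e > 0" for e
      using small that C connected_imp_chain[OF C] by blast
    then show ?thesis by (metis dist_pos_lt less_irrefl)
  qed
  then show "totally_disconnected X"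
    by (auto simp: totally_disconnected_def)
qed

section \<open>Shadowing makes chains short\<close>

lemma iterate_nat: "n \<ge> 0 \<Longrightarrow> iterate X f n = f ^^ nat n"
  by (simp add: iterate_def)

text \<open>
  The pseudo-orbit waits at \<open>x\<close> in the past, runs through the chain with one point per block of
  \<open>n\<close> steps, and waits at \<open>y\<close> from then on. One \<open>e\<close> in the bound is for shadowing at \<open>x\<close>, one for
  shadowing at \<open>y\<close>, and one for the return of the shadowing point.
\<close>
lemma (in distal_system) shadowing_bounds_chains:
  assumes shadow: "\<And>\<xi>. pseudo_orbit X f d \<xi> \<Longrightarrow> can_be_shadowed X f e \<xi>"
    and "d > 0" "e > 0" "x \<in> X" and ch: "chain X (d / 2) x y"
  shows "dist x y \<le> 3 * e"
proof -
  have "\<exists>k z. z 0 = x \<and> z k = y \<and>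
      (\<forall>i<k. z i \<in> X \<and> z (Suc i) \<in> X \<and> dist (z i) (z (Suc i)) < d / 2)"
    using ch by (simp add: chain_def rtranclp_power relpowp_fun_conv)
  then obtain k z where z: "z 0 = x" "z k = y"
    and step: "\<And>i. i < k \<Longrightarrow> z i \<in> X \<and> z (Suc i) \<in> X \<and> dist (z i) (z (Suc i)) < d / 2"
    by metis
  have zX: "z i \<in> X" if "i \<le> k" for i
    using that step[of "i - 1"] z(1) \<open>x \<in> X\<close> by (cases i) auto
  obtain n where n: "n > 0" "\<And>i. i \<le> k \<Longrightarrow> dist ((f ^^ n) (z i)) (z i) < d / 2"
    by (rule simultaneous_recurrence[of "z ` {..k}" "d / 2"]) (use zX \<open>d > 0\<close> in auto)
  \<comment> \<open>Clamping the index extends the chain to all integers, constantly \<open>x\<close> and constantly \<open>y\<close> on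
    the two sides.\<close>
  define c where "c j = z (nat (min (max j 0) (int k)))" for j
  have cX: "c j \<in> X" for j unfolding c_def by (rule zX) auto
  have c_return: "dist ((f ^^ n) (c j)) (c j) < d / 2" for j
    unfolding c_def by (rule n) auto
  have c_step: "dist (c j) (c (j + 1)) < d / 2" for j
  proof (cases "0 \<le> j \<and> j < int k")
    case True
    then have "c j = z (nat j)" "c (j + 1) = z (Suc (nat j))"
      by (auto simp: c_def nat_add_distrib)
    then show ?thesis using step[of "nat j"] True by (simp add: nat_less_iff)
  next
    case False
    then have "min (max j 0) (int k) = min (max (j + 1) 0) (int k)" by auto
    then have "c j = c (j + 1)" unfolding c_def by simp
    then show ?thesis using \<open>d > 0\<close> by simp
  qed
  define \<xi> where "\<xi> m = (f ^^ nat (m mod int n)) (c (m div int n))" for m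
  have "pseudo_orbit X f d \<xi>"
    unfolding pseudo_orbit_def
  proof (intro conjI allI)
    show "\<xi> m \<in> X" for m by (simp add: \<xi>_def funpow_in cX)
    fix m
    define q r where "q = m div int n" and "r = m mod int n"
    have m: "m = q * int n + r" by (simp add: q_def r_def)
    have r: "0 \<le> r" "r < int n" using \<open>n > 0\<close> by (auto simp: r_def)
    have f\<xi>: "f (\<xi> m) = (f ^^ nat (r + 1)) (c q)"
      using r by (simp add: \<xi>_def q_def[symmetric] r_def[symmetric] nat_add_distrib)
    show "dist (f (\<xi> m)) (\<xi> (m + 1)) \<le> d"
    proof (cases "r + 1 = int n")
      case True
      then have "m + 1 = (q + 1) * int n" by (simp add: m algebra_simps)
      then have "\<xi> (m + 1) = c (q + 1)" using \<open>n > 0\<close> by (simp add: \<xi>_def)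
      moreover have "f (\<xi> m) = (f ^^ n) (c q)" using f\<xi> True by simp
      moreover have "dist ((f ^^ n) (c q)) (c (q + 1)) < d / 2 + d / 2"
        using dist_triangle_less_add[of _ "c q"] c_return c_step by (metis dist_commute)
      ultimately show ?thesis by simp
    next
      case False
      then have "(m + 1) div int n = q" "(m + 1) mod int n = r + 1"
        using r by (auto simp: m intro: int_div_pos_eq int_mod_pos_eq)
      then have "\<xi> (m + 1) = f (\<xi> m)" by (simp add: \<xi>_def[of "m + 1"] f\<xi>)
      then show ?thesis using \<open>d > 0\<close> by simp
    qed
  qed
  then obtain w where w: "w \<in> X" "\<And>m. dist (iterate X f m w) (\<xi> m) \<le> e"
    using shadow unfolding can_be_shadowed_def by blast
  \<comment> \<open>A positive multiple of \<open>n * Suc k\<close> consists of more than \<open>k\<close> blocks, so the pseudo-orbit has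
    reached \<open>y\<close> by then; \<open>Suc k\<close> rather than \<open>k\<close> covers the chain of length \<open>0\<close>.\<close>
  obtain N where N: "N > 0" "n * Suc k dvd N" "dist ((f ^^ N) w) w < e"
    by (rule simultaneous_recurrence_multiple[of "{w}" e "n * Suc k"])
      (use w(1) \<open>n > 0\<close> \<open>e > 0\<close> in auto)
  then obtain j where j: "N = n * (Suc k * j)" "j > 0"
    by (metis dvdE gr0I mult.assoc mult_0_right)
  have "\<xi> 0 = x" by (simp add: \<xi>_def c_def z)
  then have near_x: "dist w x \<le> e" using w(2)[of 0] by (simp add: iterate_nat)
  have "k \<le> Suc k * j" using j(2) by (cases j) auto
  then have "min (max (int (Suc k * j)) 0) (int k) = int k" by linarith
  then have "c (int (Suc k * j)) = y" unfolding c_def by (simp add: z del: mult_Suc of_nat_mult)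
  moreover have "\<xi> (int N) = c (int (Suc k * j))"
    using \<open>n > 0\<close> by (simp add: \<xi>_def j del: mult_Suc)
  ultimately have "\<xi> (int N) = y" by simp
  then have near_y: "dist ((f ^^ N) w) y \<le> e" using w(2)[of "int N"] by (simp add: iterate_nat)
  have "dist x y \<le> dist x w + dist w ((f ^^ N) w) + dist ((f ^^ N) w) y"
    using dist_triangle[of x y w] dist_triangle[of w y "(f ^^ N) w"] by linarith
  then show ?thesis using near_x near_y N(3) by (simp add: dist_commute)
qed

section \<open>Invariant equivalence relations\<close>

text \<open>
  If \<open>f ^^ n\<close> carries \<open>a\<close> and \<open>b\<close> back into their own classes, equivalence of the two images at
  time \<open>n\<close> gives equivalence of \<open>a\<close> and \<open>b\<close>. Hence the whole future determines the present.
  The classes are uniformly open, so a limit of pairs violating this for longer and longer finite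
  futures would violate it for the whole future.
\<close>
lemma (in distal_system) finite_future_determines_present:
  assumes close_R: "\<And>x y. \<lbrakk>x \<in> X; y \<in> X; dist x y < d\<rbrakk> \<Longrightarrow> R x y" and "d > 0"
    and sym: "\<And>x y. R x y \<Longrightarrow> R y x" and trans: "\<And>x y z. R x y \<Longrightarrow> R y z \<Longrightarrow> R x z"
  obtains N where "\<forall>a\<in>X. \<forall>b\<in>X. (\<forall>n. 0 < n \<and> n \<le> N \<longrightarrow> R ((f ^^ n) a) ((f ^^ n) b)) \<longrightarrow> R a b"
proof -
  have past: "R a b"
    if ab: "a \<in> X" "b \<in> X" and later: "\<And>n. n > 0 \<Longrightarrow> R ((f ^^ n) a) ((f ^^ n) b)" for a b
  proof -
    obtain n where "n > 0" "dist ((f ^^ n) a) a < d" "dist ((f ^^ n) b) b < d"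
      by (rule simultaneous_recurrence[of "{a, b}" d]) (use ab \<open>d > 0\<close> in auto)
    then show ?thesis
      using later[of n] close_R funpow_in ab sym trans by meson
  qed
  show thesis
  proof (rule ccontr)
    assume "\<not> thesis"
    then have "\<forall>N. \<exists>p. p \<in> X \<times> X \<and> \<not> R (fst p) (snd p)
        \<and> (\<forall>n. 0 < n \<and> n \<le> N \<longrightarrow> R ((f ^^ n) (fst p)) ((f ^^ n) (snd p)))"
      using that by (metis fst_conv snd_conv mem_Sigma_iff)
    then obtain s where s: "\<And>N. s N \<in> X \<times> X" and notR: "\<And>N. \<not> R (fst (s N)) (snd (s N))"
      and agree: "\<And>N n. 0 < n \<Longrightarrow> n \<le> N \<Longrightarrow> R ((f ^^ n) (fst (s N))) ((f ^^ n) (snd (s N)))"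
      by metis
    have "compact (X \<times> X)" using compact compact_Times by blast
    then obtain l r where l: "l \<in> X \<times> X" and r: "strict_mono r" and lim: "(s \<circ> r) \<longlonglongrightarrow> l"
      using s unfolding compact_def by metis
    have sX: "fst (s i) \<in> X" "snd (s i) \<in> X" for i using s[of i] by auto
    have lX: "fst l \<in> X" "snd l \<in> X" using l by auto
    have lim1: "(\<lambda>i. fst (s (r i))) \<longlonglongrightarrow> fst l" and lim2: "(\<lambda>i. snd (s (r i))) \<longlonglongrightarrow> snd l"
      using tendsto_fst[OF lim] tendsto_snd[OF lim] by (simp_all add: o_def)
    have close: "\<forall>\<^sub>F i in sequentially. dist ((f ^^ n) (fst (s (r i)))) ((f ^^ n) (fst l)) < d
        \<and> dist ((f ^^ n) (snd (s (r i)))) ((f ^^ n) (snd l)) < d" for n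
    proof -
      have "(\<lambda>i. (f ^^ n) (fst (s (r i)))) \<longlonglongrightarrow> (f ^^ n) (fst l)"
        "(\<lambda>i. (f ^^ n) (snd (s (r i)))) \<longlonglongrightarrow> (f ^^ n) (snd l)"
        by (rule continuous_on_tendsto_compose[OF continuous_on_funpow]; simp add: lim1 lim2 lX sX)+
      then show ?thesis using \<open>d > 0\<close> by (auto intro: eventually_conj dest: tendstoD)
    qed
    have transfer: "R ((f ^^ n) (fst (s (r i)))) ((f ^^ n) (snd (s (r i))))
        \<longleftrightarrow> R ((f ^^ n) (fst l)) ((f ^^ n) (snd l))"
      if "dist ((f ^^ n) (fst (s (r i)))) ((f ^^ n) (fst l)) < d
        \<and> dist ((f ^^ n) (snd (s (r i)))) ((f ^^ n) (snd l)) < d" for i n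
      using that close_R sym trans funpow_in sX lX by meson
    have "R (fst l) (snd l)"
    proof (rule past[OF lX])
      fix n :: nat assume "n > 0"
      obtain i where "i \<ge> n" "dist ((f ^^ n) (fst (s (r i)))) ((f ^^ n) (fst l)) < d
          \<and> dist ((f ^^ n) (snd (s (r i)))) ((f ^^ n) (snd l)) < d"
        using close[of n] unfolding eventually_sequentially by (metis nat_le_linear)
      moreover have "R ((f ^^ n) (fst (s (r i)))) ((f ^^ n) (snd (s (r i))))"
        using agree[OF \<open>n > 0\<close>] seq_suble[OF r, of i] \<open>i \<ge> n\<close> by auto
      ultimately show "R ((f ^^ n) (fst l)) ((f ^^ n) (snd l))" using transfer by blast
    qed
    moreover obtain i where "dist (fst (s (r i))) (fst l) < d \<and> dist (snd (s (r i))) (snd l) < d"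
      using close[of 0] by (auto simp: eventually_sequentially)
    ultimately show False using transfer[of 0 i] notR by auto
  qed
qed

text \<open>
  Agreement at the times \<open>0 .. N\<close> is pulled back by \<open>f\<close>, where \<open>N\<close> is the bound from
  \<open>finite_future_determines_present\<close>: agreement at the times \<open>1 .. N + 1\<close> forces it at time
  \<open>0\<close>. Conversely, equivalent points \<open>a\<close> and \<open>b\<close> have a later time at which both are back in their class,
  and pulling this equivalence back leads to \<open>f a\<close> and \<open>f b\<close>.
\<close>
lemma (in distal_system) invariant_equivalence:
  assumes small: "\<And>x y. \<lbrakk>x \<in> X; y \<in> X; chain X d x y\<rbrakk> \<Longrightarrow> dist x y < e" and "d > 0"
  obtains d' E where "d' > 0" "\<And>x y. \<lbrakk>x \<in> X; y \<in> X; dist x y < d'\<rbrakk> \<Longrightarrow> E x y"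
    "\<And>x y. \<lbrakk>x \<in> X; y \<in> X; E x y\<rbrakk> \<Longrightarrow> dist x y < e"
    "\<And>x y. E x y \<Longrightarrow> E y x" "\<And>x y z. E x y \<Longrightarrow> E y z \<Longrightarrow> E x z"
    "\<And>x y. \<lbrakk>x \<in> X; y \<in> X\<rbrakk> \<Longrightarrow> E (f x) (f y) \<longleftrightarrow> E x y"
proof -
  define R where "R = chain X d"
  have R_close: "R x y" if "x \<in> X" "y \<in> X" "dist x y < d" for x y
    using that by (simp add: R_def chain_step)
  have R_sym: "R x y \<Longrightarrow> R y x" and R_trans: "R x y \<Longrightarrow> R y z \<Longrightarrow> R x z" for x y z
    by (auto simp: R_def intro: chain_sym chain_trans)
  obtain N where N: "\<forall>a\<in>X. \<forall>b\<in>X. (\<forall>n. 0 < n \<and> n \<le> N \<longrightarrow> R ((f ^^ n) a) ((f ^^ n) b)) \<longrightarrow> R a b"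
    by (rule finite_future_determines_present[OF R_close \<open>d > 0\<close> R_sym R_trans])
  define E where "E a b \<longleftrightarrow> (\<forall>n\<le>N. R ((f ^^ n) a) ((f ^^ n) b))" for a b
  have E_sym: "E x y \<Longrightarrow> E y x" and E_trans: "E x y \<Longrightarrow> E y z \<Longrightarrow> E x z" for x y z
    unfolding E_def using R_sym R_trans by blast+
  have "\<exists>d'>0. \<forall>x\<in>X. \<forall>y\<in>X. dist x y < d' \<longrightarrow> (\<forall>n\<le>k. dist ((f ^^ n) x) ((f ^^ n) y) < d)" for k
  proof (induction k)
    case 0
    then show ?case using \<open>d > 0\<close> by auto
  next
    case (Suc k)
    then obtain d1 where d1: "d1 > 0"
      "\<forall>x\<in>X. \<forall>y\<in>X. dist x y < d1 \<longrightarrow> (\<forall>n\<le>k. dist ((f ^^ n) x) ((f ^^ n) y) < d)" by blast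
    have "uniformly_continuous_on X (f ^^ Suc k)"
      using compact_uniformly_continuous continuous_on_funpow compact by blast
    then obtain d2 where d2: "d2 > 0"
      "\<forall>x\<in>X. \<forall>y\<in>X. dist x y < d2 \<longrightarrow> dist ((f ^^ Suc k) x) ((f ^^ Suc k) y) < d"
      using \<open>d > 0\<close> unfolding uniformly_continuous_on_def by (metis dist_commute)
    show ?case
      using d1 d2 by (intro exI[of _ "min d1 d2"]) (auto simp: le_Suc_eq simp del: funpow.simps)
  qed
  then obtain d' where "d' > 0" and d': "\<And>x y n. \<lbrakk>x \<in> X; y \<in> X; dist x y < d'; n \<le> N\<rbrakk>
      \<Longrightarrow> dist ((f ^^ n) x) ((f ^^ n) y) < d" by metis
  have E_close: "E x y" if "x \<in> X" "y \<in> X" "dist x y < d'" for x y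
    using that d' by (auto simp: E_def R_close funpow_in)
  have backward: "E a b" if "a \<in> X" "b \<in> X" "E (f a) (f b)" for a b
  proof -
    have later: "R ((f ^^ Suc i) a) ((f ^^ Suc i) b)" if "i \<le> N" for i
      using that \<open>E (f a) (f b)\<close> by (simp add: E_def funpow_swap1)
    have "R ((f ^^ n) a) ((f ^^ n) b)" if "0 < n" "n \<le> N" for n
      using later[of "n - 1"] that by (cases n) auto
    moreover from this have "R a b" using N \<open>a \<in> X\<close> \<open>b \<in> X\<close> by blast
    ultimately show ?thesis
      unfolding E_def by (metis funpow_0 gr0I)
  qed
  have backward_funpow: "E a b" if "a \<in> X" "b \<in> X" "E ((f ^^ n) a) ((f ^^ n) b)" for a b n
    using that
  proof (induction n)
    case (Suc n)
    then show ?case using backward funpow_in by auto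
  qed auto
  have forward: "E (f a) (f b)" if "a \<in> X" "b \<in> X" "E a b" for a b
  proof -
    obtain n where n: "n > 0" "dist ((f ^^ n) a) a < d'" "dist ((f ^^ n) b) b < d'"
      by (rule simultaneous_recurrence[of "{a, b}" d']) (use \<open>a \<in> X\<close> \<open>b \<in> X\<close> \<open>d' > 0\<close> in auto)
    then have "E ((f ^^ n) a) ((f ^^ n) b)"
      using that E_close funpow_in E_sym E_trans by meson
    moreover obtain i where "n = Suc i" using \<open>n > 0\<close> by (cases n) auto
    ultimately have "E ((f ^^ i) (f a)) ((f ^^ i) (f b))"
      by (simp add: funpow_swap1)
    then show ?thesis using backward_funpow that maps by blast
  qed
  show thesis
  proof (rule that[of d' E])
    show "dist x y < e" if "x \<in> X" "y \<in> X" "E x y" for x y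
      using that small by (force simp: E_def R_def)
  qed (use \<open>d' > 0\<close> E_close E_sym backward forward in \<open>blast intro: E_trans\<close>)+
qed

lemma iterate_succ:
  assumes "bij_betw f X X" "x \<in> X"
  shows "iterate X f m x \<in> X" "f (iterate X f m x) = iterate X f (m + 1) x"
proof -
  have f: "f y \<in> X" "inv_into X f y \<in> X" "f (inv_into X f y) = y" if "y \<in> X" for y
    using assms(1) that by (auto simp: bij_betw_def inv_into_into f_inv_into_f)
  have inX: "(inv_into X f ^^ n) x \<in> X" "(f ^^ n) x \<in> X" for n
    by (induction n) (auto simp: f \<open>x \<in> X\<close>)
  then show "iterate X f m x \<in> X" by (auto simp: iterate_def)
  show "f (iterate X f m x) = iterate X f (m + 1) x"
  proof (cases "m \<ge> 0")
    case True
    then show ?thesis by (simp add: iterate_def nat_add_distrib)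
  next
    case False
    then obtain n where m: "m = - int (Suc n)"
      using negD by force
    have "f ((inv_into X f ^^ Suc n) x) = (inv_into X f ^^ n) x"
      using f inX by simp
    moreover have "iterate X f m = inv_into X f ^^ Suc n"
      by (simp add: iterate_def m nat_add_distrib del: funpow.simps)
    moreover have "iterate X f (m + 1) = inv_into X f ^^ n"
      by (cases n) (simp_all add: iterate_def m nat_add_distrib del: funpow.simps(2))
    ultimately show ?thesis by simp
  qed
qed

text \<open>
  Time \<open>n + 1\<close> follows from time \<open>n\<close> because \<open>f\<close> preserves \<open>E\<close>, and time \<open>n - 1\<close> because \<open>f\<close> also
  reflects it.
\<close>
lemma invariant_equivalence_shadows:
  assumes bij: "bij_betw f X X"
    and sym: "\<And>x y. E x y \<Longrightarrow> E y x" and trans: "\<And>x y z. E x y \<Longrightarrow> E y z \<Longrightarrow> E x z"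
    and inv: "\<And>x y. \<lbrakk>x \<in> X; y \<in> X\<rbrakk> \<Longrightarrow> E (f x) (f y) \<longleftrightarrow> E x y"
    and \<xi>X: "\<And>n. \<xi> n \<in> X" and jump: "\<And>n. E (f (\<xi> n)) (\<xi> (n + 1))" and "E (\<xi> 0) (\<xi> 0)"
  shows "E (iterate X f n (\<xi> 0)) (\<xi> n)"
proof (induction n rule: int_induct[of _ 0])
  case base
  show ?case using \<open>E (\<xi> 0) (\<xi> 0)\<close> by (simp add: iterate_def)
next
  case (step1 i)
  then show ?case using iterate_succ[OF bij \<xi>X] inv \<xi>X jump trans by metis
next
  case (step2 i)
  have "E (iterate X f i (\<xi> 0)) (f (\<xi> (i - 1)))"
    using step2 jump[of "i - 1"] sym trans by (metis diff_add_cancel)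
  then show ?case
    using iterate_succ[OF bij \<xi>X, of "i - 1" 0] inv \<xi>X by (metis diff_add_cancel)
qed

theorem corollary1p10:
  fixes X :: "'a::metric_space set" and f :: "'a \<Rightarrow> 'a"
  assumes "compact X"
    and "\<exists>g. homeomorphism X X f g"
    and "distal X f"
  shows "POTP X f \<longleftrightarrow> totally_disconnected X"
proof -
  obtain g where g: "homeomorphism X X f g" using assms(2) by blast
  have bij: "bij_betw f X X"
    by (rule bij_betw_byWitness[of _ g]) (use g in \<open>auto simp: homeomorphism_def\<close>)
  interpret distal_system X f
  proof
    show "compact X" by fact
    show "continuous_on X f" "f \<in> X \<rightarrow> X" using g by (auto simp: homeomorphism_def)
    fix x y assume "x \<in> X" "y \<in> X" "x \<noteq> y"
    define e where "e = (INF n. dist (iterate X f n x) (iterate X f n y))"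
    have "e > 0" using assms(3) \<open>x \<in> X\<close> \<open>y \<in> X\<close> \<open>x \<noteq> y\<close> by (simp add: distal_def e_def)
    moreover have "e \<le> dist (iterate X f m x) (iterate X f m y)" for m
      unfolding e_def by (rule cINF_lower) (auto intro: bdd_belowI[of _ 0])
    then have "e \<le> dist ((f ^^ n) x) ((f ^^ n) y)" for n
      by (metis iterate_nat nat_int of_nat_0_le_iff)
    ultimately show "\<exists>e>0. \<forall>n. e \<le> dist ((f ^^ n) x) ((f ^^ n) y)" by blast
  qed
  show ?thesis
    unfolding totally_disconnected_iff_chains[OF assms(1)]
  proof (intro iffI allI impI)
    fix e :: real assume "POTP X f" "e > 0"
    then obtain d where "d > 0" "\<And>\<xi>. pseudo_orbit X f d \<xi> \<Longrightarrow> can_be_shadowed X f (e / 4) \<xi>"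
      unfolding POTP_def by (metis zero_less_divide_iff zero_less_numeral)
    then have "dist x y < e" if "x \<in> X" "chain X (d / 2) x y" for x y
      using shadowing_bounds_chains[of d "e / 4" x y] that \<open>e > 0\<close> by simp
    then show "\<exists>d>0. \<forall>x\<in>X. \<forall>y\<in>X. chain X d x y \<longrightarrow> dist x y < e"
      using \<open>d > 0\<close> by (intro exI[of _ "d / 2"]) auto
  next
    assume chains: "\<forall>e>0. \<exists>d>0. \<forall>x\<in>X. \<forall>y\<in>X. chain X d x y \<longrightarrow> dist x y < e"
    show "POTP X f"
      unfolding POTP_def
    proof (intro allI impI)
      fix e :: real assume "e > 0"
      then obtain d where d: "d > 0" "\<And>x y. \<lbrakk>x \<in> X; y \<in> X; chain X d x y\<rbrakk> \<Longrightarrow> dist x y < e"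
        using chains by metis
      show "\<exists>d>0. \<forall>\<xi>. pseudo_orbit X f d \<xi> \<longrightarrow> can_be_shadowed X f e \<xi>"
      proof (rule invariant_equivalence[OF d(2,1)])
        fix d' E assume E: "d' > 0" "\<And>x y. \<lbrakk>x \<in> X; y \<in> X; dist x y < d'\<rbrakk> \<Longrightarrow> E x y"
          "\<And>x y. \<lbrakk>x \<in> X; y \<in> X; E x y\<rbrakk> \<Longrightarrow> dist x y < e"
          "\<And>x y. E x y \<Longrightarrow> E y x" "\<And>x y z. E x y \<Longrightarrow> E y z \<Longrightarrow> E x z"
          "\<And>x y. \<lbrakk>x \<in> X; y \<in> X\<rbrakk> \<Longrightarrow> E (f x) (f y) \<longleftrightarrow> E x y"
        \<comment> \<open>Half of \<open>d'\<close>, because a pseudo-orbit may attain its bound.\<close>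
        have "can_be_shadowed X f e \<xi>" if "pseudo_orbit X f (d' / 2) \<xi>" for \<xi>
        proof -
          have \<xi>X: "\<xi> n \<in> X" and jump: "dist (f (\<xi> n)) (\<xi> (n + 1)) \<le> d' / 2" for n
            using that unfolding pseudo_orbit_def by blast+
          have "dist (f (\<xi> n)) (\<xi> (n + 1)) < d'" for n
            using jump[of n] \<open>d' > 0\<close> by linarith
          then have E_jump: "E (f (\<xi> n)) (\<xi> (n + 1))" for n
            using E(2) \<xi>X maps by blast
          have E_refl: "E (\<xi> 0) (\<xi> 0)" using E(1,2) \<xi>X by simp
          have "E (iterate X f n (\<xi> 0)) (\<xi> n)" for n
            by (rule invariant_equivalence_shadows[where E = E and \<xi> = \<xi>, OF bij])
              (fact E(4) E(5) E(6) \<xi>X E_jump E_refl)+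
          then have "dist (iterate X f n (\<xi> 0)) (\<xi> n) \<le> e" for n
            using E(3)[OF iterate_succ(1)[OF bij \<xi>X] \<xi>X] by (simp add: less_imp_le)
          then show ?thesis
            unfolding can_be_shadowed_def using \<xi>X by blast
        qed
        then show ?thesis
          using \<open>d' > 0\<close> by (intro exI[of _ "d' / 2"]) auto
      qed
    qed
  qed
qed

end
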